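(* Let $M$ be a matroid of odd rank $r$. Then $$\left[t^{\lfloor (r-1)/2\rfloor}\right]P_M(t)=\left[t^{\lfloor (r-1)/2\rfloor}\right]Q_M(t).$$ In particular, a matroid $M$ of odd rank $r$ is non-degenerate if and only if $Q_M(t)$ has degree $\lfloor (r-1)/2\rfloor$.
   Context: $[t^j]p(t)$ denotes the coefficient of $t^j$ in a polynomial $p(t)$. For a matroid $M$ of rank $r$ with ground set $E$, let $\mathscr{L}(M)$ be its lattice of flats ordered by inclusion, with minimum $\hat 0$ (the closure of the empty set) and maximum $E$, rank function $\operatorname{rk}$ and Möbius function $\mu$. The characteristic polynomial is $\chi_M(t)=\sum_{F\in\mathscr{L}(M)}\mu(\hat 0,F)\,t^{r-\operatorname{rk}F}$. For a flat $F$, $M_F$ is the restriction of $M$ to $F$ (lattice of flats $[\hat 0,F]$, rank $\operatorname{rk}F$) and $M^F$ is the contraction $M/F$ (lattice of flats $[F,E]$, rank $r-\operatorname{rk}F$); all quantities depend only on the lattice of flats. The Kazhdan–Lusztig polynomial $P_M(t)$ and inverse Kazhdan–Lusztig polynomial $Q_M(t)$ are the unique assignment of polynomials in $\mathbb{Z}[t]$ to every matroid such that: if $r=0$ then $P_M=Q_M=1$; if $r>0$ then $\deg P_M<r/2$ and $\deg Q_M<r/2$; and for every $M$, $t^rP_M(t^{-1})=\sum_{F\in\mathscr{L}(M)}\chi_{M_F}(t)P_{M^F}(t)$ and $(-1)^r t^rQ_M(t^{-1})=\sum_{F\in\mathscr{L}(M)}(-1)^{\operatorname{rk}F}Q_{M_F}(t)\,t^{r-\operatorname{rk}F}\chi_{M^F}(t^{-1})$.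 A matroid $M$ of rank $r$ is degenerate if $\deg P_M(t)<\lfloor (r-1)/2\rfloor$, and non-degenerate otherwise. *)

theory Defs
  imports "HOL-Computational_Algebra.Polynomial"
begin

section \<open>Finite matroids\<close>

definition matroid_axioms :: "'a set \<Rightarrow> 'a set set \<Rightarrow> bool" where
  "matroid_axioms E \<I> \<longleftrightarrow>
     finite E \<and> \<I> \<subseteq> Pow E \<and> {} \<in> \<I> \<and>
     (\<forall>I J. J \<in> \<I> \<longrightarrow> I \<subseteq> J \<longrightarrow> I \<in> \<I>) \<and>
     (\<forall>I J. I \<in> \<I> \<longrightarrow> J \<in> \<I> \<longrightarrow> card I < card J \<longrightarrow> (\<exists>e\<in>J - I. insert e I \<in> \<I>))"

typedef 'a matroid = "{(E :: 'a set, \<I>). matroid_axioms E \<I>}"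
proof
  show "({}, {{}}) \<in> {(E :: 'a set, \<I>). matroid_axioms E \<I>}"
    by (auto simp: matroid_axioms_def)
qed

setup_lifting type_definition_matroid

lift_definition ground :: "'a matroid \<Rightarrow> 'a set" is fst .

lift_definition indeps :: "'a matroid \<Rightarrow> 'a set set" is snd .

lemma matroid_axioms_indeps: "matroid_axioms (ground M) (indeps M)"
  by transfer auto

definition rk :: "'a matroid \<Rightarrow> 'a set \<Rightarrow> nat" where
  "rk M X = Max (card ` {I \<in> indeps M. I \<subseteq> X})"

definition rank :: "'a matroid \<Rightarrow> nat" where
  "rank M = rk M (ground M)"

definition cl :: "'a matroid \<Rightarrow> 'a set \<Rightarrow> 'a set" where
  "cl M X = {e \<in> ground M. rk M (insert e X) = rk M X}"

definition flats :: "'a matroid \<Rightarrow> 'a set set" where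
  "flats M = {F. F \<subseteq> ground M \<and> cl M F = F}"

definition basis_in :: "'a set set \<Rightarrow> 'a set \<Rightarrow> 'a set \<Rightarrow> bool" where
  "basis_in \<I> X B \<longleftrightarrow> B \<in> \<I> \<and> B \<subseteq> X \<and> (\<forall>e\<in>X - B. insert e B \<notin> \<I>)"

lemma basis_in_card_le:
  assumes "matroid_axioms E \<I>" "basis_in \<I> X A" "basis_in \<I> X B"
  shows "card B \<le> card A"
proof (rule ccontr)
  assume "\<not> card B \<le> card A"
  then have "\<exists>e\<in>B - A. insert e A \<in> \<I>"
    using assms unfolding matroid_axioms_def basis_in_def by (meson not_le)
  then show False
    using assms(2,3) unfolding basis_in_def by blast
qed

lemma basis_in_exists:
  assumes "matroid_axioms E \<I>"
  shows "\<exists>B. basis_in \<I> X B"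
proof -
  let ?S = "{B \<in> \<I>. B \<subseteq> X}"
  have fin: "finite \<I>"
    using assms unfolding matroid_axioms_def by (meson finite_Pow_iff finite_subset)
  have "{} \<in> ?S"
    using assms unfolding matroid_axioms_def by blast
  then obtain B where B: "B \<in> ?S" "\<And>C. C \<in> ?S \<Longrightarrow> B \<subseteq> C \<Longrightarrow> B = C"
    using fin finite_has_maximal[of ?S] by auto
  have "insert e B \<notin> \<I>" if "e \<in> X - B" for e
    using B(1) B(2)[of "insert e B"] that by auto
  then show ?thesis
    using B(1) unfolding basis_in_def by blast
qed

lift_definition restriction :: "'a matroid \<Rightarrow> 'a set \<Rightarrow> 'a matroid" is
  "\<lambda>(E, \<I>) X. (E \<inter> X, {I \<in> \<I>. I \<subseteq> X})"
proof -
  fix p :: "'a set \<times> 'a set set" and X :: "'a set"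
  assume "p \<in> {(E, \<I>). matroid_axioms E \<I>}"
  then obtain E \<I> where p: "p = (E, \<I>)" and M: "matroid_axioms E \<I>"
    by auto
  define \<J> where "\<J> = {I \<in> \<I>. I \<subseteq> X}"
  have fin: "finite E" and sub: "\<I> \<subseteq> Pow E" and empty: "{} \<in> \<I>"
    and down: "\<And>I J. J \<in> \<I> \<Longrightarrow> I \<subseteq> J \<Longrightarrow> I \<in> \<I>"
    and exch: "\<And>I J. I \<in> \<I> \<Longrightarrow> J \<in> \<I> \<Longrightarrow> card I < card J \<Longrightarrow> \<exists>e\<in>J - I. insert e I \<in> \<I>"
    using M unfolding matroid_axioms_def by blast+
  have "finite (E \<inter> X)" "\<J> \<subseteq> Pow (E \<inter> X)" "{} \<in> \<J>"
    using fin sub empty unfolding \<J>_def by auto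
  moreover have "I \<in> \<J>" if "J \<in> \<J>" "I \<subseteq> J" for I J
    using down that unfolding \<J>_def by auto
  moreover have "\<exists>e\<in>J - I. insert e I \<in> \<J>"
    if "I \<in> \<J>" "J \<in> \<J>" "card I < card J" for I J
    using exch[of I J] that unfolding \<J>_def by auto
  ultimately have "matroid_axioms (E \<inter> X) \<J>"
    unfolding matroid_axioms_def by blast
  then show "(case p of (E, \<I>) \<Rightarrow> \<lambda>X. (E \<inter> X, {I \<in> \<I>. I \<subseteq> X})) X
      \<in> {(E, \<I>). matroid_axioms E \<I>}"
    unfolding p \<J>_def by simp
qed

lift_definition contraction :: "'a matroid \<Rightarrow> 'a set \<Rightarrow> 'a matroid" is
  "\<lambda>(E, \<I>) X. (E - X, {I. I \<subseteq> E - X \<and> (\<exists>B. basis_in \<I> X B \<and> I \<union> B \<in> \<I>)})"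
proof -
  fix p :: "'a set \<times> 'a set set" and X :: "'a set"
  assume "p \<in> {(E, \<I>). matroid_axioms E \<I>}"
  then obtain E \<I> where p: "p = (E, \<I>)" and M: "matroid_axioms E \<I>"
    by auto
  define \<J> where "\<J> = {I. I \<subseteq> E - X \<and> (\<exists>B. basis_in \<I> X B \<and> I \<union> B \<in> \<I>)}"
  have fin: "finite E" and sub: "\<I> \<subseteq> Pow E"
    and down: "\<And>I J. J \<in> \<I> \<Longrightarrow> I \<subseteq> J \<Longrightarrow> I \<in> \<I>"
    and exch: "\<And>I J. I \<in> \<I> \<Longrightarrow> J \<in> \<I> \<Longrightarrow> card I < card J \<Longrightarrow> \<exists>e\<in>J - I. insert e I \<in> \<I>"
    using M unfolding matroid_axioms_def by blast+
  have "{} \<in> \<J>"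
    using basis_in_exists[OF M, of X] unfolding \<J>_def basis_in_def by auto
  moreover have "I \<in> \<J>" if J: "J \<in> \<J>" "I \<subseteq> J" for I J
  proof -
    obtain B where "J \<subseteq> E - X" "basis_in \<I> X B" "J \<union> B \<in> \<I>"
      using J(1) unfolding \<J>_def by auto
    moreover from this have "I \<union> B \<in> \<I>"
      using down J(2) by (meson Un_mono order_refl)
    ultimately show ?thesis
      using J(2) unfolding \<J>_def by auto
  qed
  moreover have "\<exists>e\<in>J - I. insert e I \<in> \<J>"
    if I: "I \<in> \<J>" and J: "J \<in> \<J>" and less: "card I < card J" for I J
  proof -
    obtain A where A: "I \<subseteq> E - X" "basis_in \<I> X A" "I \<union> A \<in> \<I>"
      using I unfolding \<J>_def by auto
    obtain B where B: "J \<subseteq> E - X" "basis_in \<I> X B" "J \<union> B \<in> \<I>"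
      using J unfolding \<J>_def by auto
    have AB: "A \<subseteq> X" "B \<subseteq> X" "finite A" "finite B"
      using A(2) B(2) sub fin unfolding basis_in_def by (auto intro: finite_subset)
    have "card A = card B"
      using basis_in_card_le[OF M] A(2) B(2) by (meson le_antisym)
    moreover have "card (I \<union> A) = card I + card A"
      using A(1) AB fin by (intro card_Un_disjoint) (auto intro: finite_subset)
    moreover have "card (J \<union> B) = card J + card B"
      using B(1) AB fin by (intro card_Un_disjoint) (auto intro: finite_subset)
    ultimately have "card (I \<union> A) < card (J \<union> B)"
      using less by simp
    then obtain e where e: "e \<in> (J \<union> B) - (I \<union> A)" "insert e (I \<union> A) \<in> \<I>"
      using exch A(3) B(3) by blast
    have "e \<notin> B"
    proof
      assume "e \<in> B"
      then have "e \<in> X - A" using e(1) AB by auto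
      moreover have "insert e A \<in> \<I>" using down[OF e(2)] by auto
      ultimately show False using A(2) unfolding basis_in_def by blast
    qed
    then have "e \<in> J - I" using e(1) by auto
    moreover have "insert e I \<in> \<J>"
      using \<open>e \<in> J - I\<close> A B(1) e(2) unfolding \<J>_def by auto
    ultimately show ?thesis by blast
  qed
  moreover have "\<J> \<subseteq> Pow (E - X)" unfolding \<J>_def by auto
  ultimately have "matroid_axioms (E - X) \<J>"
    using fin unfolding matroid_axioms_def by blast
  then show "(case p of (E, \<I>) \<Rightarrow> \<lambda>X. (E - X, {I. I \<subseteq> E - X \<and>
      (\<exists>B. basis_in \<I> X B \<and> I \<union> B \<in> \<I>)})) X \<in> {(E, \<I>). matroid_axioms E \<I>}"
    unfolding p \<J>_def by simp
qed

section \<open>Moebius function and characteristic polynomial\<close>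

text \<open>Values are meaningful for \<open>F, G \<in> L\<close>; \<open>L\<close> is ordered by inclusion.\<close>

function moebius :: "'a set set \<Rightarrow> 'a set \<Rightarrow> 'a set \<Rightarrow> int" where
  "moebius L F G =
     (if \<not> finite G \<or> \<not> F \<subseteq> G then 0
      else if F = G then 1
      else - (\<Sum>H \<in> {H \<in> L. F \<subseteq> H \<and> H \<subset> G}. moebius L F H))"
  by auto
termination
  by (relation "Wellfounded.measure (\<lambda>(L, F, G). card G)") (auto intro: psubset_card_mono)

declare moebius.simps [simp del]

definition char_poly :: "'a matroid \<Rightarrow> int poly" where
  "char_poly M =
     (\<Sum>F\<in>flats M. monom (moebius (flats M) (cl M {}) F) (rank M - rk M F))"

section \<open>Kazhdan--Lusztig polynomials\<close>

text \<open>\<open>rev_poly n p\<close> is \<open>t ^ n * p (1 / t)\<close>; it is only meaningful for \<open>degree p \<le> n\<close>,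
  which holds at each of its uses below.\<close>

definition rev_poly :: "nat \<Rightarrow> int poly \<Rightarrow> int poly" where
  "rev_poly n p = (\<Sum>i\<le>n. monom (coeff p i) (n - i))"

lemma coeff_rev_poly: "coeff (rev_poly n p) i = (if i \<le> n then coeff p (n - i) else 0)"
proof -
  have "coeff (rev_poly n p) i = (\<Sum>j\<le>n. if n - j = i then coeff p j else 0)"
    by (simp add: rev_poly_def coeff_sum)
  also have "\<dots> = (\<Sum>j\<le>n. if j = n - i then (if i \<le> n then coeff p j else 0) else 0)"
    by (intro sum.cong) auto
  also have "\<dots> = (if i \<le> n then coeff p (n - i) else 0)"
    by simp
  finally show ?thesis .
qed

lemma poly_rev_poly:
  fixes x :: "'b :: field_char_0"
  assumes "degree p \<le> n" "x \<noteq> 0"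
  shows "poly (map_poly of_int (rev_poly n p)) x = x ^ n * poly (map_poly of_int p) (1 / x)"
proof -
  have eval: "poly (map_poly of_int q) y = (\<Sum>i\<le>n. of_int (coeff q i) * y ^ i)"
    if "degree q \<le> n" for q and y :: 'b
  proof -
    have "poly (map_poly of_int q) y = (\<Sum>i\<le>degree q. of_int (coeff q i) * y ^ i)"
      by (simp add: poly_altdef degree_map_poly coeff_map_poly)
    also have "\<dots> = (\<Sum>i\<le>n. of_int (coeff q i) * y ^ i)"
      using that by (intro sum.mono_neutral_left) (auto simp: coeff_eq_0)
    finally show ?thesis .
  qed
  have "degree (rev_poly n p) \<le> n"
    by (rule degree_le) (simp add: coeff_rev_poly)
  then have "poly (map_poly of_int (rev_poly n p)) x = (\<Sum>i\<le>n. of_int (coeff p (n - i)) * x ^ i)"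
    by (simp add: eval coeff_rev_poly)
  also have "\<dots> = (\<Sum>i\<le>n. of_int (coeff p i) * x ^ (n - i))"
    by (rule sum.reindex_bij_witness[of _ "\<lambda>i. n - i" "\<lambda>i. n - i"]) auto
  also have "\<dots> = x ^ n * (\<Sum>i\<le>n. of_int (coeff p i) * (1 / x) ^ i)"
    unfolding sum_distrib_left using assms(2)
    by (intro sum.cong) (auto simp: power_diff power_one_over)
  finally show ?thesis
    by (simp add: eval[OF assms(1)])
qed

definition is_KL_assignment :: "('a matroid \<Rightarrow> int poly) \<Rightarrow> bool" where
  "is_KL_assignment P \<longleftrightarrow>
     (\<forall>M. rank M = 0 \<longrightarrow> P M = 1) \<and>
     (\<forall>M. rank M > 0 \<longrightarrow> real (degree (P M)) < real (rank M) / 2) \<and>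
     (\<forall>M. rev_poly (rank M) (P M) =
        (\<Sum>F\<in>flats M. char_poly (restriction M F) * P (contraction M F)))"

definition is_inverse_KL_assignment :: "('a matroid \<Rightarrow> int poly) \<Rightarrow> bool" where
  "is_inverse_KL_assignment Q \<longleftrightarrow>
     (\<forall>M. rank M = 0 \<longrightarrow> Q M = 1) \<and>
     (\<forall>M. rank M > 0 \<longrightarrow> real (degree (Q M)) < real (rank M) / 2) \<and>
     (\<forall>M. (- 1) ^ rank M * rev_poly (rank M) (Q M) =
        (\<Sum>F\<in>flats M. (- 1) ^ rk M F * Q (restriction M F) *
           rev_poly (rank M - rk M F) (char_poly (contraction M F))))"

text \<open>All minors of a matroid over \<open>'a\<close> are again matroids over \<open>'a\<close>, so the defining
  recursions determine the polynomials within each type \<open>'a matroid\<close>.\<close>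

definition KL_poly :: "'a matroid \<Rightarrow> int poly" where
  "KL_poly = (THE P. is_KL_assignment P)"

definition inverse_KL_poly :: "'a matroid \<Rightarrow> int poly" where
  "inverse_KL_poly = (THE Q. is_inverse_KL_assignment Q)"

text \<open>For rank 0 the truncated subtraction is harmless: the polynomial is then 1,
  and neither \<open>0 < 0\<close> nor \<open>0 < -1\<close> holds.\<close>

definition degenerate :: "'a matroid \<Rightarrow> bool" where
  "degenerate M \<longleftrightarrow> degree (KL_poly M) < (rank M - 1) div 2"

end

(* The product (f * g)(M) = sum over flats F of f(M|F) g(M/F) is associative, because iterated
   minors along a chain of flats are equal as labelled matroids. With Qs(M) = (-1)^r Q(M) the two
   recursions read P^rev = chi * P and Qs^rev = Qs * chi^rev, and chi^rev is inverse to chi. Hence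
   (Qs * P)^rev = Qs * chi^rev * chi * P = Qs * P, while (Qs * P)(M) has degree < r/2 when r > 0,
   so (Qs * P)(M) = 0. For r odd only the flats of rank 0 and r contribute to its coefficient at
   (r-1)/2, which gives [t^((r-1)/2)] (P - Q) = 0.
   Qs is constructed by recursion on restrictions alone; P is then obtained as its left inverse. *)
theory Submission
  imports Defs
begin

section \<open>Rank function and flats\<close>

text \<open>The obstacle is loops. Minors are labelled, so contracting the loops of M keeps its rank
  but may give a different matroid, and the rank-0 indicator \<open>unit_fun\<close> is a unit only
  on the right. At the top flat, restriction returns M itself; at the bottom flat, contraction
  returns M without its loops. Equations can therefore be solved and cancelled through the top flat,
  not directly through the bottom one. This decides the order of construction: the recursion for Qs
  has its unknown at the top flat, the one for P at the bottom flat. Invariance under removal of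
  loops, \<open>conv unit_fun f = f\<close>, is never built in; it follows by associativity for the
  Moebius function, then for the characteristic polynomial, and finally for every solution P. Both
  polynomials are definite descriptions, so existence and uniqueness of the two assignments must be
  settled before any coefficient can be compared.\<close>

lemma finite_ground: "finite (ground M)"
  and indep_subset_ground: "I \<in> indeps M \<Longrightarrow> I \<subseteq> ground M"
  and empty_indep: "{} \<in> indeps M"
  and indep_subset: "J \<in> indeps M \<Longrightarrow> I \<subseteq> J \<Longrightarrow> I \<in> indeps M"
  and indep_exchange: "I \<in> indeps M \<Longrightarrow> J \<in> indeps M \<Longrightarrow> card I < card J \<Longrightarrow>
        \<exists>e\<in>J - I. insert e I \<in> indeps M"
  using matroid_axioms_indeps[of M] unfolding matroid_axioms_def by blast+

lemma finite_indep: "I \<in> indeps M \<Longrightarrow> finite I"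
  using finite_ground indep_subset_ground by (metis finite_subset)

lemma finite_indeps: "finite (indeps M)"
  using finite_ground indep_subset_ground by (metis Pow_iff finite_Pow_iff finite_subset subsetI)

lemma finite_Collect_indeps [simp]: "finite {I \<in> indeps M. P I}"
  by (rule finite_subset[OF _ finite_indeps[of M]]) auto

lemma card_le_rk: "I \<in> indeps M \<Longrightarrow> I \<subseteq> X \<Longrightarrow> card I \<le> rk M X"
  unfolding rk_def by (intro Max_ge) auto

lemma card_basis_in:
  assumes "basis_in (indeps M) X B"
  shows "card B = rk M X"
proof (rule antisym)
  show "card B \<le> rk M X"
    using assms by (auto simp: basis_in_def intro: card_le_rk)
  have "card I \<le> card B" if I: "I \<in> indeps M" "I \<subseteq> X" for I
  proof (rule ccontr)
    assume "\<not> card I \<le> card B"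
    then obtain e where "e \<in> I - B" "insert e B \<in> indeps M"
      using indep_exchange[of B M I] assms I(1) by (auto simp: basis_in_def)
    then show False
      using assms I(2) by (auto simp: basis_in_def)
  qed
  moreover have "{I \<in> indeps M. I \<subseteq> X} \<noteq> {}"
    using empty_indep by auto
  ultimately show "rk M X \<le> card B"
    unfolding rk_def by (subst Max_le_iff) auto
qed

lemma basis_in_extend:
  assumes "I \<in> indeps M" "I \<subseteq> X"
  obtains B where "I \<subseteq> B" "basis_in (indeps M) X B"
proof -
  let ?S = "{B \<in> indeps M. I \<subseteq> B \<and> B \<subseteq> X}"
  have "I \<in> ?S"
    using assms by auto
  then have "\<exists>B\<in>?S. \<forall>C\<in>?S. B \<subseteq> C \<longrightarrow> B = C"
    by (intro finite_has_maximal finite_Collect_indeps) auto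
  then obtain B where B: "B \<in> ?S" "\<forall>C\<in>?S. B \<subseteq> C \<longrightarrow> B = C"
    by (rule bexE)
  have "insert e B \<notin> indeps M" if "e \<in> X - B" for e
    using B(1) bspec[OF B(2), of "insert e B"] that by auto
  with B(1) show thesis
    by (intro that[of B]) (auto simp: basis_in_def)
qed

lemma rk_mono: "X \<subseteq> Y \<Longrightarrow> rk M X \<le> rk M Y"
proof -
  assume XY: "X \<subseteq> Y"
  obtain B where B: "basis_in (indeps M) X B"
    using basis_in_extend[OF empty_indep, of X] by blast
  then show "rk M X \<le> rk M Y"
    using XY card_le_rk[of B M Y] card_basis_in[OF B] by (auto simp: basis_in_def)
qed

lemma indep_iff_rk: "I \<in> indeps M \<longleftrightarrow> I \<subseteq> ground M \<and> rk M I = card I"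
proof (intro iffI conjI)
  assume I: "I \<in> indeps M"
  then have "basis_in (indeps M) I I"
    by (auto simp: basis_in_def)
  then show "rk M I = card I"
    using card_basis_in by metis
  show "I \<subseteq> ground M"
    using I by (rule indep_subset_ground)
next
  assume I: "I \<subseteq> ground M \<and> rk M I = card I"
  obtain B where B: "basis_in (indeps M) I B"
    using basis_in_extend[OF empty_indep, of I] by blast
  have "finite I"
    using I finite_ground finite_subset by blast
  then have "B = I"
    using I B card_basis_in[OF B] by (intro card_subset_eq) (auto simp: basis_in_def)
  with B show "I \<in> indeps M"
    by (simp add: basis_in_def)
qed

text \<open>Independent sets are the subsets of the ground set whose rank equals their size.
  Identities between iterated minors thus reduce to rank formulas, with no choice of bases.\<close>

lemma matroid_eqI:
  assumes "ground M = ground N" "\<And>X. X \<subseteq> ground M \<Longrightarrow> rk M X = rk N X"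
  shows "M = N"
proof -
  have "indeps M = indeps N"
    using assms by (auto simp: indep_iff_rk)
  with assms(1) show ?thesis
    by transfer auto
qed

lemma rk_empty [simp]: "rk M {} = 0"
  using empty_indep[of M] by (simp add: indep_iff_rk)

text \<open>This is submodularity in local form. Extend a basis \<open>B\<close> of \<open>X\<close>
  to a basis \<open>C\<close> of \<open>Y\<close>: if \<open>e\<close> enlarged \<open>C\<close>, it
  would also enlarge \<open>B\<close>.\<close>

lemma rk_insert_eq_mono:
  assumes "X \<subseteq> Y" "e \<in> ground M" "rk M (insert e X) = rk M X"
  shows "rk M (insert e Y) = rk M Y"
proof (rule ccontr)
  assume neq: "rk M (insert e Y) \<noteq> rk M Y"
  then have less: "rk M Y < rk M (insert e Y)"
    using rk_mono[OF subset_insertI, of M Y e] by linarith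
  obtain B where B: "basis_in (indeps M) X B"
    using basis_in_extend[OF empty_indep, of X] by blast
  then obtain C where C: "B \<subseteq> C" "basis_in (indeps M) Y C"
    using basis_in_extend[of B M Y] assms(1) by (auto simp: basis_in_def)
  obtain D where D: "basis_in (indeps M) (insert e Y) D"
    using basis_in_extend[OF empty_indep, of "insert e Y"] by blast
  obtain d where d: "d \<in> D - C" "insert d C \<in> indeps M"
    using indep_exchange[of C M D] C(2) D card_basis_in[OF C(2)] card_basis_in[OF D] less
    by (auto simp: basis_in_def)
  \<comment> \<open>\<open>C\<close> is maximal independent inside \<open>Y\<close>, so the element
    gained by exchange lies outside \<open>Y\<close>.\<close>
  then have "d = e"
    using C(2) D by (auto simp: basis_in_def)
  with d C(1) have "insert e B \<in> indeps M" "e \<notin> B"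
    using indep_subset[of "insert e C" M "insert e B"] by auto
  moreover have "card (insert e B) \<le> rk M (insert e X)"
    using calculation B by (intro card_le_rk) (auto simp: basis_in_def)
  moreover have "finite B"
    using B finite_indep by (auto simp: basis_in_def)
  ultimately show False
    using card_basis_in[OF B] assms(3) by simp
qed

section \<open>Flats and loops\<close>

lemma flats_iff:
  "F \<in> flats M \<longleftrightarrow> F \<subseteq> ground M \<and> (\<forall>e\<in>ground M - F. rk M (insert e F) \<noteq> rk M F)"
  by (auto simp: flats_def cl_def insert_absorb)

lemma flat_subset_ground: "F \<in> flats M \<Longrightarrow> F \<subseteq> ground M"
  by (simp add: flats_def)

lemma ground_in_flats [simp]: "ground M \<in> flats M"
  by (simp add: flats_iff)

lemma finite_flats [simp]: "finite (flats M)"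
  using finite_ground flat_subset_ground by (metis Pow_iff finite_Pow_iff finite_subset subsetI)

lemma rk_flat_less:
  assumes "F \<in> flats M" "F \<subset> X" "X \<subseteq> ground M"
  shows "rk M F < rk M X"
proof -
  obtain e where e: "e \<in> X - F"
    using assms(2) by auto
  have "rk M F \<noteq> rk M (insert e F)"
    using assms e unfolding flats_iff by force
  moreover have "rk M F \<le> rk M (insert e F)" "rk M (insert e F) \<le> rk M X"
    using e assms(2) by (auto intro!: rk_mono)
  ultimately show ?thesis by linarith
qed

lemma rk_le_rank: "F \<in> flats M \<Longrightarrow> rk M F \<le> rank M"
  unfolding rank_def by (intro rk_mono flat_subset_ground)

lemma rk_less_rank: "F \<in> flats M \<Longrightarrow> F \<noteq> ground M \<Longrightarrow> rk M F < rank M"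
  unfolding rank_def using flat_subset_ground[of F M] by (intro rk_flat_less) auto

lemma flats_rank_0: "rank M = 0 \<Longrightarrow> flats M = {ground M}"
  using rk_less_rank[of _ M] ground_in_flats[of M] by fastforce

lemma loops_subset_flat: "F \<in> flats M \<Longrightarrow> cl M {} \<subseteq> F"
proof
  fix e assume F: "F \<in> flats M" and "e \<in> cl M {}"
  then have "e \<in> ground M" "rk M (insert e F) = rk M F"
    using rk_insert_eq_mono[of "{}" F e M] by (auto simp: cl_def)
  with F show "e \<in> F"
    by (auto simp: flats_iff)
qed

lemma rk_loops [simp]: "rk M (cl M {}) = 0"
proof -
  obtain B where B: "basis_in (indeps M) (cl M {}) B"
    using basis_in_extend[OF empty_indep, of "cl M {}"] by blast
  have "e \<notin> B" for e
  proof
    assume "e \<in> B"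
    then have "rk M {e} = 0" "{e} \<in> indeps M"
      using B indep_subset[of B M "{e}"] by (auto simp: basis_in_def cl_def)
    then show False
      by (simp add: indep_iff_rk)
  qed
  then have "B = {}" by blast
  with card_basis_in[OF B] show ?thesis by simp
qed

lemma loops_in_flats [simp]: "cl M {} \<in> flats M"
  unfolding flats_iff
proof (intro conjI ballI notI)
  show "cl M {} \<subseteq> ground M"
    by (auto simp: cl_def)
  fix e assume e: "e \<in> ground M - cl M {}" "rk M (insert e (cl M {})) = rk M (cl M {})"
  have "rk M {e} \<le> rk M (insert e (cl M {}))"
    by (intro rk_mono) auto
  then have "rk M {e} = 0"
    using e(2) by simp
  with e(1) show False
    by (auto simp: cl_def)
qed

lemma flat_rk_0_iff: "F \<in> flats M \<Longrightarrow> rk M F = 0 \<longleftrightarrow> F = cl M {}"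
  using rk_flat_less[of "cl M {}" M F] loops_subset_flat[of F M] flat_subset_ground[of F M]
  by (cases "F = cl M {}") (auto simp: psubset_eq)

section \<open>Minors\<close>

lemma ground_restriction: "F \<subseteq> ground M \<Longrightarrow> ground (restriction M F) = F"
  by transfer auto

lemma indeps_restriction: "indeps (restriction M F) = {I \<in> indeps M. I \<subseteq> F}"
  by transfer auto

lemma ground_contraction: "ground (contraction M F) = ground M - F"
  by transfer auto

lemma indeps_contraction:
  "indeps (contraction M F) =
     {I. I \<subseteq> ground M - F \<and> (\<exists>B. basis_in (indeps M) F B \<and> I \<union> B \<in> indeps M)}"
  by transfer auto

lemma rk_restriction: "X \<subseteq> F \<Longrightarrow> rk (restriction M F) X = rk M X"
  unfolding rk_def indeps_restriction by (rule arg_cong[of _ _ "\<lambda>S. Max (card ` S)"]) auto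

lemma rank_restriction: "F \<subseteq> ground M \<Longrightarrow> rank (restriction M F) = rk M F"
  by (simp add: rank_def ground_restriction rk_restriction)

text \<open>For one inequality, glue a basis of \<open>X\<close> in the contraction to the basis
  \<open>A\<close> of \<open>F\<close> that witnesses its independence. For the other, extend
  \<open>A\<close> to a basis \<open>C\<close> of \<open>X \<union> F\<close>: maximality of
  \<open>A\<close> in \<open>F\<close> forces \<open>C \<inter> F = A\<close>, so
  \<open>C - A\<close> lies in \<open>X\<close> and is independent in the contraction.\<close>

lemma rk_contraction:
  assumes "X \<subseteq> ground M - F"
  shows "rk (contraction M F) X = rk M (X \<union> F) - rk M F"
proof -
  obtain I where I: "basis_in (indeps (contraction M F)) X I"
    using basis_in_extend[OF empty_indep, of X "contraction M F"] by blast
  then obtain A where A: "basis_in (indeps M) F A" "I \<union> A \<in> indeps M" "I \<subseteq> ground M - F"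
    by (auto simp: basis_in_def indeps_contraction)
  have "card I + card A = card (I \<union> A)"
    using A(1,3) finite_indep[OF A(2)] by (subst card_Un_disjoint) (auto simp: basis_in_def)
  also have "\<dots> \<le> rk M (X \<union> F)"
    using A I by (intro card_le_rk) (auto simp: basis_in_def)
  finally have le: "rk (contraction M F) X + rk M F \<le> rk M (X \<union> F)"
    using card_basis_in[OF I] card_basis_in[OF A(1)] by simp
  obtain C where C: "A \<subseteq> C" "basis_in (indeps M) (X \<union> F) C"
    using basis_in_extend[of A M "X \<union> F"] A(1) by (auto simp: basis_in_def)
  have CF: "C \<inter> F = A"
  proof
    show "A \<subseteq> C \<inter> F"
      using A(1) C(1) by (auto simp: basis_in_def)
    have "e \<in> A" if "e \<in> C \<inter> F" for e
    proof (rule ccontr)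
      assume "e \<notin> A"
      moreover have "insert e A \<in> indeps M"
        using indep_subset[of C M "insert e A"] C that by (auto simp: basis_in_def)
      ultimately show False
        using A(1) that by (auto simp: basis_in_def)
    qed
    then show "C \<inter> F \<subseteq> A" by blast
  qed
  have CX: "C - A \<subseteq> X"
    using C(2) CF unfolding basis_in_def by blast
  have "(C - A) \<union> A \<in> indeps M"
    using C by (simp add: basis_in_def Un_absorb2)
  with A(1) CX assms have "C - A \<in> indeps (contraction M F)"
    unfolding indeps_contraction by blast
  then have "card (C - A) \<le> rk (contraction M F) X"
    using CX by (rule card_le_rk)
  moreover have "card C = card (C - A) + card A"
    using C finite_indep[of C M] finite_indep[of A M] A(1) card_Diff_subset[of A C] card_mono[of C A]
    by (auto simp: basis_in_def)
  ultimately show ?thesis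
    using le card_basis_in[OF C(2)] card_basis_in[OF A(1)] by simp
qed

lemma rank_contraction:
  assumes "F \<subseteq> ground M"
  shows "rank (contraction M F) = rank M - rk M F"
  using assms by (simp add: rank_def ground_contraction rk_contraction Un_absorb2)

lemma restriction_ground [simp]: "restriction M (ground M) = M"
  by (rule matroid_eqI) (simp_all add: ground_restriction rk_restriction)

lemma restriction_restriction:
  assumes "G \<subseteq> F" "F \<subseteq> ground M"
  shows "restriction (restriction M F) G = restriction M G"
  using assms by (intro matroid_eqI) (auto simp: ground_restriction rk_restriction)

lemma contraction_restriction:
  assumes "G \<subseteq> F" "F \<subseteq> ground M"
  shows "contraction (restriction M F) G = restriction (contraction M G) (F - G)"
proof (rule matroid_eqI)
  show "ground (contraction (restriction M F) G) = ground (restriction (contraction M G) (F - G))"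
    using assms by (subst ground_restriction) (auto simp: ground_contraction ground_restriction)
  fix X assume "X \<subseteq> ground (contraction (restriction M F) G)"
  then have X: "X \<subseteq> F - G"
    using assms by (auto simp: ground_contraction ground_restriction)
  have "rk (contraction (restriction M F) G) X = rk M (X \<union> G) - rk M G"
  proof -
    have "X \<union> G \<subseteq> F"
      using X assms(1) by blast
    then show ?thesis
      using X assms by (simp add: rk_contraction ground_restriction rk_restriction)
  qed
  moreover have "rk (contraction M G) X = rk M (X \<union> G) - rk M G"
    using X assms by (subst rk_contraction) auto
  ultimately show "rk (contraction (restriction M F) G) X = rk (restriction (contraction M G) (F - G)) X"
    using X by (simp add: rk_restriction)
qed

lemma contraction_contraction:
  assumes "G \<subseteq> F" "F \<subseteq> ground M"
  shows "contraction (contraction M G) (F - G) = contraction M F"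
proof (rule matroid_eqI)
  show "ground (contraction (contraction M G) (F - G)) = ground (contraction M F)"
    using assms by (auto simp: ground_contraction)
  fix X assume "X \<subseteq> ground (contraction (contraction M G) (F - G))"
  then have X: "X \<subseteq> ground M - F"
    using assms by (auto simp: ground_contraction)
  have "X \<union> (F - G) \<union> G = X \<union> F" "F - G \<union> G = F"
    using assms by auto
  \<comment> \<open>This inequality lets the truncated differences telescope.\<close>
  moreover have "rk M G \<le> rk M F"
    using assms(1) by (rule rk_mono)
  moreover have "X \<subseteq> ground (contraction M G) - (F - G)" "X \<union> (F - G) \<subseteq> ground M - G"
    "F - G \<subseteq> ground M - G"
    using X assms by (auto simp: ground_contraction)
  ultimately show "rk (contraction (contraction M G) (F - G)) X = rk (contraction M F) X"
    using X by (simp add: rk_contraction)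
qed

lemma flats_restriction:
  assumes "F \<in> flats M"
  shows "flats (restriction M F) = {G \<in> flats M. G \<subseteq> F}"
proof -
  have F: "F \<subseteq> ground M"
    using assms by (rule flat_subset_ground)
  have "G \<in> flats M" if G: "G \<in> flats (restriction M F)" for G
    unfolding flats_iff
  proof (intro conjI ballI notI)
    have GF: "G \<subseteq> F"
      using flat_subset_ground[OF G] F by (simp add: ground_restriction)
    then show "G \<subseteq> ground M"
      using F by blast
    fix e assume e: "e \<in> ground M - G" "rk M (insert e G) = rk M G"
    have "rk M (insert e F) = rk M F"
      using rk_insert_eq_mono[of G F e M] GF e by simp
    then have "e \<in> F"
      using assms e(1) by (auto simp: flats_iff)
    with e GF G F show False
      by (auto simp: flats_iff ground_restriction rk_restriction)
  qed
  moreover have "G \<subseteq> F" if "G \<in> flats (restriction M F)" for G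
    using flat_subset_ground[OF that] F by (simp add: ground_restriction)
  moreover have "G \<in> flats (restriction M F)" if "G \<in> flats M" "G \<subseteq> F" for G
    using that F by (auto simp: flats_iff ground_restriction rk_restriction)
  ultimately show ?thesis by blast
qed

text \<open>Ranks in the contraction are ranks in \<open>M\<close> shifted by the constant
  \<open>rk M F\<close>, so an element raises the rank of \<open>G - F\<close> there exactly when it
  raises the rank of \<open>G\<close> in \<open>M\<close>.\<close>

lemma diff_in_flats_contraction_iff:
  assumes "F \<subseteq> G" "G \<subseteq> ground M"
  shows "G - F \<in> flats (contraction M F) \<longleftrightarrow> G \<in> flats M"
proof -
  have "rk (contraction M F) (G - F) = rk M G - rk M F"
    using assms by (subst rk_contraction) (auto simp: Un_absorb1 Un_absorb2)
  moreover have "rk (contraction M F) (insert e (G - F)) = rk M (insert e G) - rk M F"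
    if "e \<in> ground M - G" for e
    using assms that by (subst rk_contraction) (auto simp: Un_absorb1 Un_absorb2)
  moreover have "rk M F \<le> rk M G" "rk M G \<le> rk M (insert e G)" for e
    using assms by (auto intro: rk_mono)
  moreover have "ground M - F - (G - F) = ground M - G" "G - F \<subseteq> ground M - F"
    using assms by auto
  ultimately show ?thesis
    unfolding flats_iff ground_contraction using assms(2)
    by (metis (no_types, lifting) diff_le_self eq_diff_iff order_trans)
qed

lemma bij_betw_flats_contraction:
  assumes "F \<in> flats M"
  shows "bij_betw (\<lambda>G. G - F) {G \<in> flats M. F \<subseteq> G} (flats (contraction M F))"
proof (rule bij_betw_byWitness[of _ "\<lambda>H. H \<union> F"])
  show "(\<lambda>G. G - F) ` {G \<in> flats M. F \<subseteq> G} \<subseteq> flats (contraction M F)"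
    using diff_in_flats_contraction_iff flat_subset_ground by blast
  show "(\<lambda>H. H \<union> F) ` flats (contraction M F) \<subseteq> {G \<in> flats M. F \<subseteq> G}"
  proof (intro image_subsetI CollectI conjI)
    fix H assume H: "H \<in> flats (contraction M F)"
    have "H \<subseteq> ground M - F"
      using flat_subset_ground[OF H] by (simp add: ground_contraction)
    moreover from this have "H \<union> F - F = H" by auto
    ultimately show "H \<union> F \<in> flats M"
      using H assms diff_in_flats_contraction_iff[of F "H \<union> F" M] flat_subset_ground[OF assms]
      by auto
  qed auto
  show "\<forall>H\<in>flats (contraction M F). H \<union> F - F = H"
    using flat_subset_ground by (fastforce simp: ground_contraction)
qed auto

section \<open>Convolution over flats\<close>

definition conv :: "('a matroid \<Rightarrow> 'b :: comm_ring_1) \<Rightarrow> ('a matroid \<Rightarrow> 'b) \<Rightarrow> 'a matroid \<Rightarrow> 'b" where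
  "conv f g M = (\<Sum>F\<in>flats M. f (restriction M F) * g (contraction M F))"

definition unit_fun :: "'a matroid \<Rightarrow> 'b :: comm_ring_1" where
  "unit_fun M = (if rank M = 0 then 1 else 0)"

lemma conv_assoc:
  fixes f g h :: "'a matroid \<Rightarrow> 'b :: comm_ring_1"
  shows "conv (conv f g) h = conv f (conv g h)"
proof
  fix M :: "'a matroid"
  let ?L = "flats M"
  let ?t = "\<lambda>F G. f (restriction M G) * g (contraction (restriction M F) G) * h (contraction M F)"
  have "conv (conv f g) h M = (\<Sum>F\<in>?L. \<Sum>G\<in>{G \<in> ?L. G \<subseteq> F}. ?t F G)"
    unfolding conv_def sum_distrib_right
    by (intro sum.cong)
      (auto simp: flats_restriction restriction_restriction flat_subset_ground)
  \<comment> \<open>Both triple products are sums over chains of flats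
    \<open>G \<subseteq> F\<close>; one side fixes \<open>F\<close> first, the other
    \<open>G\<close>.\<close>
  also have "\<dots> = (\<Sum>G\<in>?L. \<Sum>F\<in>{F \<in> ?L. G \<subseteq> F}. ?t F G)"
    by (intro sum.swap_restrict) auto
  also have "\<dots> = conv f (conv g h) M"
    unfolding conv_def
  proof (intro sum.cong refl)
    fix G assume G: "G \<in> ?L"
    have "(\<Sum>H\<in>flats (contraction M G). g (restriction (contraction M G) H) * h (contraction (contraction M G) H))
        = (\<Sum>F\<in>{F \<in> ?L. G \<subseteq> F}. g (contraction (restriction M F) G) * h (contraction M F))"
      by (subst sum.reindex_bij_betw[OF bij_betw_flats_contraction[OF G], symmetric])
        (auto intro!: sum.cong simp: contraction_restriction contraction_contraction flat_subset_ground)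
    then show "(\<Sum>F\<in>{F \<in> ?L. G \<subseteq> F}. ?t F G) = f (restriction M G) *
        (\<Sum>H\<in>flats (contraction M G). g (restriction (contraction M G) H) * h (contraction (contraction M G) H))"
      by (simp add: sum_distrib_left mult.assoc)
  qed
  finally show "conv (conv f g) h M = conv f (conv g h) M" .
qed

lemma rank_restriction_flat: "F \<in> flats M \<Longrightarrow> rank (restriction M F) = rk M F"
  and rank_contraction_flat: "F \<in> flats M \<Longrightarrow> rank (contraction M F) = rank M - rk M F"
  by (simp_all add: rank_restriction rank_contraction flat_subset_ground)

lemma rank_contraction_ground [simp]: "rank (contraction M (ground M)) = 0"
  by (simp add: rank_contraction) (simp add: rank_def)

lemma rank_contraction_loops [simp]: "rank (contraction M (cl M {})) = rank M"
  by (simp add: rank_contraction_flat)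

lemma conv_split:
  "conv f g M = f M * g (contraction M (ground M)) +
     (\<Sum>F\<in>flats M - {ground M}. f (restriction M F) * g (contraction M F))"
  unfolding conv_def by (subst sum.remove[of _ "ground M"]) auto

lemma conv_unit_right [simp]:
  fixes f :: "'a matroid \<Rightarrow> 'b :: comm_ring_1"
  shows "conv f unit_fun = f"
proof
  fix M :: "'a matroid"
  have "unit_fun (contraction M F) = (0 :: 'b)" if "F \<in> flats M - {ground M}" for F
    using that rk_less_rank[of F M] by (simp add: unit_fun_def rank_contraction_flat)
  then have "(\<Sum>F\<in>flats M - {ground M}. f (restriction M F) * unit_fun (contraction M F)) = 0"
    by (intro sum.neutral) simp
  then show "conv f unit_fun M = f M"
    by (simp add: conv_split unit_fun_def)
qed

text \<open>Loops are the only obstruction to \<^const>\<open>unit_fun\<close> being a two-sided unit.\<close>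

lemma conv_unit_left: "conv unit_fun f M = f (contraction M (cl M {}))"
proof -
  have "conv unit_fun f M = (\<Sum>F\<in>flats M. if F = cl M {} then f (contraction M F) else 0)"
    unfolding conv_def
    by (intro sum.cong) (auto simp: unit_fun_def rank_restriction_flat flat_rk_0_iff)
  then show ?thesis by simp
qed

section \<open>Cancellation and inverses for the convolution\<close>

definition normalized :: "('a matroid \<Rightarrow> 'b :: comm_ring_1) \<Rightarrow> bool" where
  "normalized f \<longleftrightarrow> (\<forall>M. rank M = 0 \<longrightarrow> f M = 1)"

lemma normalizedD: "normalized f \<Longrightarrow> rank M = 0 \<Longrightarrow> f M = 1"
  by (simp add: normalized_def)

text \<open>The term of the top flat is \<open>f M\<close> times 1, and all other terms involve
  \<open>f\<close> only at restrictions of smaller rank.\<close>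

lemma conv_right_cancel:
  assumes g: "normalized g" and eq: "conv f g = conv f' g"
  shows "f = f'"
proof
  fix M
  show "f M = f' M"
  proof (induction "rank M" arbitrary: M rule: less_induct)
    case less
    have "(\<Sum>F\<in>flats M - {ground M}. f (restriction M F) * g (contraction M F)) =
        (\<Sum>F\<in>flats M - {ground M}. f' (restriction M F) * g (contraction M F))"
      using less by (intro sum.cong) (auto simp: rank_restriction_flat rk_less_rank)
    with fun_cong[OF eq, of M] g show ?case
      by (simp add: conv_split normalized_def)
  qed
qed

text \<open>The equation \<open>conv x g = unit_fun\<close> solved for its top-flat term, with
  \<open>g\<close> taken to be 1 in rank 0.\<close>

function left_inverse :: "('a matroid \<Rightarrow> 'b :: comm_ring_1) \<Rightarrow> 'a matroid \<Rightarrow> 'b" where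
  "left_inverse g M = unit_fun M -
     (\<Sum>F\<in>flats M - {ground M}. left_inverse g (restriction M F) * g (contraction M F))"
  by auto
termination
  by (relation "Wellfounded.measure (\<lambda>(g, M). rank M)")
    (auto simp: rank_restriction_flat rk_less_rank)

declare left_inverse.simps [simp del]

lemma conv_left_inverse:
  assumes "normalized g"
  shows "conv (left_inverse g) g = unit_fun"
proof
  fix M :: "'a matroid"
  show "conv (left_inverse g) g M = unit_fun M"
    using assms by (simp add: conv_split normalizedD left_inverse.simps[of g M])
qed

lemma left_inverse_normalized: "normalized (left_inverse g)"
  unfolding normalized_def
proof (intro allI impI)
  fix M :: "'a matroid" assume "rank M = 0"
  then show "left_inverse g M = 1"
    by (simp add: left_inverse.simps[of g M] unit_fun_def flats_rank_0)
qed

text \<open>By associativity \<open>g * f * g = g * unit_fun = g\<close>, and loop invariance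
  rewrites the last \<open>g\<close> as \<open>unit_fun * g\<close>; now cancel \<open>g\<close> on
  the right.\<close>

lemma conv_right_inverse:
  assumes g: "normalized g" and fg: "conv f g = unit_fun" and inv: "conv unit_fun g = g"
  shows "conv g f = unit_fun"
proof (rule conv_right_cancel[OF g])
  show "conv (conv g f) g = conv unit_fun g"
    by (simp add: conv_assoc fg inv)
qed

section \<open>The characteristic polynomial as a kernel\<close>

lemma rev_poly_eq_reflect_poly:
  assumes "degree p \<le> n"
  shows "rev_poly n p = monom 1 (n - degree p) * reflect_poly p"
proof (rule poly_eqI)
  fix i
  show "coeff (rev_poly n p) i = coeff (monom 1 (n - degree p) * reflect_poly p) i"
    using assms by (auto simp: coeff_rev_poly coeff_monom_mult coeff_reflect_poly coeff_eq_0)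
qed

lemma rev_poly_mult:
  assumes "degree p \<le> m" "degree q \<le> n"
  shows "rev_poly (m + n) (p * q) = rev_poly m p * rev_poly n q"
proof (cases "p = 0 \<or> q = 0")
  case True
  then show ?thesis by (auto simp: rev_poly_def)
next
  case False
  then have deg: "degree (p * q) = degree p + degree q"
    by (simp add: degree_mult_eq)
  then have "monom 1 (m + n - degree (p * q)) = (monom 1 (m - degree p) * monom 1 (n - degree q) :: int poly)"
    using assms by (simp add: mult_monom)
  moreover have "degree (p * q) \<le> m + n"
    using deg assms by simp
  ultimately show ?thesis
    using assms by (simp only: rev_poly_eq_reflect_poly reflect_poly_mult ac_simps)
qed

lemma rev_poly_rev_poly: "degree p \<le> n \<Longrightarrow> rev_poly n (rev_poly n p) = p"
  by (rule poly_eqI) (auto simp: coeff_rev_poly coeff_eq_0)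

lemma rev_poly_sum: "rev_poly n (\<Sum>i\<in>A. f i) = (\<Sum>i\<in>A. rev_poly n (f i))"
  by (rule poly_eqI) (simp add: coeff_rev_poly coeff_sum)

lemma rev_poly_diff: "rev_poly n (p - q) = rev_poly n p - rev_poly n q"
  by (rule poly_eqI) (simp add: coeff_rev_poly)

lemma degree_rev_poly_le: "degree (rev_poly n p) \<le> n"
  by (rule degree_le) (simp add: coeff_rev_poly)

definition rev_fun :: "('a matroid \<Rightarrow> int poly) \<Rightarrow> 'a matroid \<Rightarrow> int poly" where
  "rev_fun f M = rev_poly (rank M) (f M)"

text \<open>Reversal at the rank discards coefficients above it; this bound makes it lossless, hence
  involutive and multiplicative for \<open>conv\<close>.\<close>

definition rank_bounded :: "('a matroid \<Rightarrow> int poly) \<Rightarrow> bool" where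
  "rank_bounded f \<longleftrightarrow> (\<forall>M. degree (f M) \<le> rank M)"

lemma rank_bounded_restriction:
    "rank_bounded f \<Longrightarrow> F \<in> flats M \<Longrightarrow> degree (f (restriction M F)) \<le> rk M F"
  and rank_bounded_contraction:
    "rank_bounded f \<Longrightarrow> F \<in> flats M \<Longrightarrow> degree (f (contraction M F)) \<le> rank M - rk M F"
  unfolding rank_bounded_def by (metis rank_restriction_flat, metis rank_contraction_flat)

lemma rank_bounded_conv:
  assumes "rank_bounded f" "rank_bounded g"
  shows "rank_bounded (conv f g)"
  unfolding rank_bounded_def conv_def
proof (intro allI degree_sum_le)
  fix M :: "'a matroid" and F assume F: "F \<in> flats M"
  show "degree (f (restriction M F) * g (contraction M F)) \<le> rank M"
    using rank_bounded_restriction[OF assms(1) F] rank_bounded_contraction[OF assms(2) F]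
      rk_le_rank[OF F]
    by (intro order_trans[OF degree_mult_le]) linarith
qed simp

lemma rev_poly_conv_term:
  assumes "rank_bounded f" "rank_bounded g" and F: "F \<in> flats M"
  shows "rev_poly (rank M) (f (restriction M F) * g (contraction M F)) =
      rev_fun f (restriction M F) * rev_fun g (contraction M F)"
  using rev_poly_mult[OF rank_bounded_restriction[OF assms(1) F] rank_bounded_contraction[OF assms(2) F]]
    rk_le_rank[OF F]
  by (simp add: rev_fun_def rank_restriction_flat rank_contraction_flat F)

lemma rev_fun_conv:
  assumes "rank_bounded f" "rank_bounded g"
  shows "rev_fun (conv f g) = conv (rev_fun f) (rev_fun g)"
proof
  fix M
  show "rev_fun (conv f g) M = conv (rev_fun f) (rev_fun g) M"
    unfolding rev_fun_def[of "conv f g"] conv_def rev_poly_sum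
    by (intro sum.cong refl rev_poly_conv_term assms)
qed

lemma rev_fun_rev_fun: "rank_bounded f \<Longrightarrow> rev_fun (rev_fun f) = f"
  by (auto simp: rev_fun_def rank_bounded_def rev_poly_rev_poly)

lemma rank_bounded_rev_fun: "rank_bounded (rev_fun f)"
  by (simp add: rank_bounded_def rev_fun_def degree_rev_poly_le)

lemma rev_poly_0_1 [simp]: "rev_poly 0 1 = 1"
  by (simp add: rev_poly_def monom_0 flip: one_pCons)

lemma rev_poly_zero [simp]: "rev_poly n 0 = 0"
  by (simp add: rev_poly_def)

lemma rev_fun_unit [simp]: "rev_fun unit_fun = unit_fun"
  by (auto simp: rev_fun_def unit_fun_def)

lemma normalized_rev_fun: "normalized f \<Longrightarrow> normalized (rev_fun f)"
  by (simp add: normalized_def rev_fun_def)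

lemma rank_bounded_unit: "rank_bounded unit_fun"
  by (simp add: rank_bounded_def unit_fun_def)

lemma conv_unit_left_rev_fun: "conv unit_fun (rev_fun f) = rev_fun (conv unit_fun f)"
  by (auto simp: conv_unit_left rev_fun_def)

section \<open>Moebius inversion in the convolution algebra\<close>

definition moebius_fun :: "'a matroid \<Rightarrow> int poly" where
  "moebius_fun M = [:moebius (flats M) (cl M {}) (ground M):]"

abbreviation zeta_fun :: "'a matroid \<Rightarrow> int poly" where
  "zeta_fun \<equiv> \<lambda>M. 1"

abbreviation power_fun :: "'a matroid \<Rightarrow> int poly" where
  "power_fun \<equiv> \<lambda>M. monom 1 (rank M)"

text \<open>The recursion for the value at \<open>G\<close> visits only members of the family below
  \<open>G\<close>. Hence a flat has the same Moebius value in \<open>M\<close> and in any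
  restriction of \<open>M\<close> to a flat containing it.\<close>

lemma moebius_cong:
  assumes "{H \<in> L. H \<subseteq> G} = {H \<in> L'. H \<subseteq> G}"
  shows "moebius L F G = moebius L' F G"
proof (cases "finite G")
  case True
  then show ?thesis using assms
  proof (induction G rule: finite_psubset_induct)
    case (psubset G)
    have "{H \<in> L. F \<subseteq> H \<and> H \<subset> G} = {H \<in> L'. F \<subseteq> H \<and> H \<subset> G}"
      using psubset.prems by blast
    moreover have "moebius L F H = moebius L' F H" if "H \<subset> G" for H
      using that psubset.prems by (intro psubset.IH) blast+
    ultimately show ?case
      by (auto simp: moebius.simps[of L F G] moebius.simps[of L' F G] intro!: sum.cong)
  qed
qed (simp add: moebius.simps)

lemma moebius_fun_restriction:
  assumes "F \<in> flats M"
  shows "moebius_fun (restriction M F) = [:moebius (flats M) (cl M {}) F:]"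
proof -
  have "cl (restriction M F) {} = cl M {}"
    using loops_subset_flat[OF assms] flat_subset_ground[OF assms]
    by (auto simp: cl_def ground_restriction rk_restriction)
  moreover have "moebius (flats (restriction M F)) (cl M {}) F = moebius (flats M) (cl M {}) F"
    by (rule moebius_cong) (auto simp: flats_restriction assms)
  ultimately show ?thesis
    using flat_subset_ground[OF assms] by (simp add: moebius_fun_def ground_restriction)
qed

lemma char_poly_eq_conv: "char_poly = conv moebius_fun power_fun"
proof
  fix M :: "'a matroid"
  show "char_poly M = conv moebius_fun power_fun M"
    unfolding char_poly_def conv_def
    by (intro sum.cong) (simp_all add: moebius_fun_restriction rank_contraction_flat smult_monom)
qed

text \<open>In positive rank this is the Moebius recursion at the ground set, whose value cancels
  the sum over the proper flats. In rank 0 the ground set is the only flat.\<close>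

lemma conv_moebius_zeta: "conv moebius_fun zeta_fun = unit_fun"
proof
  fix M :: "'a matroid"
  let ?m = "moebius (flats M) (cl M {})"
  let ?E = "ground M"
  have "conv moebius_fun zeta_fun M = (\<Sum>F\<in>flats M. [:?m F:])"
    by (simp add: conv_def moebius_fun_restriction)
  also have "\<dots> = [:\<Sum>F\<in>flats M. ?m F:]"
    by (rule poly_eqI) (simp add: coeff_sum coeff_pCons split: nat.split)
  also have "(\<Sum>F\<in>flats M. ?m F) = ?m ?E + (\<Sum>F\<in>flats M - {?E}. ?m F)"
    by (subst sum.remove[of _ ?E]) auto
  also have "flats M - {?E} = {H \<in> flats M. cl M {} \<subseteq> H \<and> H \<subset> ?E}"
    using loops_subset_flat flat_subset_ground by blast
  also have "?m ?E + (\<Sum>F\<in>{H \<in> flats M. cl M {} \<subseteq> H \<and> H \<subset> ?E}. ?m F) =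
      (if rank M = 0 then 1 else 0)"
  proof (cases "cl M {} = ?E")
    case True
    then have "rank M = 0"
      by (metis rank_def rk_loops)
    moreover have "(\<Sum>F\<in>{H \<in> flats M. cl M {} \<subseteq> H \<and> H \<subset> ?E}. ?m F) = 0"
      using True by (intro sum.neutral) auto
    ultimately show ?thesis
      using True finite_ground[of M] by (simp add: moebius.simps[of _ _ ?E])
  next
    case False
    then have "rank M \<noteq> 0"
      using flat_rk_0_iff[of ?E M] by (auto simp: rank_def)
    then show ?thesis
      using False finite_ground[of M] loops_subset_flat[of ?E M]
      by (simp add: moebius.simps[of _ _ ?E])
  qed
  finally show "conv moebius_fun zeta_fun M = unit_fun M"
    by (simp add: unit_fun_def flip: one_pCons)
qed

text \<open>The dual form of Moebius inversion comes from algebra alone: the zeta function is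
  constant, so it does not see loops.\<close>

lemma conv_zeta_moebius: "conv zeta_fun moebius_fun = unit_fun"
  by (rule conv_right_inverse[OF _ conv_moebius_zeta])
    (auto simp: normalized_def conv_unit_left)

text \<open>With \<open>\<mu>\<close> and \<open>\<zeta>\<close> for the Moebius and zeta functions,
  \<open>unit_fun * \<mu> = \<mu> * \<zeta> * \<mu> = \<mu> * unit_fun = \<mu>\<close>. No
  comparison of the two lattices of flats is required.\<close>

lemma conv_unit_moebius: "conv unit_fun moebius_fun = moebius_fun"
  by (metis conv_assoc conv_moebius_zeta conv_zeta_moebius conv_unit_right)

text \<open>Scaling by t to the rank respects \<open>conv\<close> because the ranks of a restriction
  and of the matching contraction add up to \<open>rank M\<close>.\<close>

lemma conv_power_fun_mult:
  "conv (\<lambda>M. f M * power_fun M) (\<lambda>M. g M * power_fun M) M = conv f g M * power_fun M"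
  unfolding conv_def sum_distrib_right
proof (intro sum.cong refl)
  fix F assume F: "F \<in> flats M"
  have "power_fun (restriction M F) * power_fun (contraction M F) = power_fun M"
    using rk_le_rank[OF F] by (simp add: mult_monom rank_restriction_flat rank_contraction_flat F)
  then show "f (restriction M F) * power_fun (restriction M F) *
      (g (contraction M F) * power_fun (contraction M F)) =
      f (restriction M F) * g (contraction M F) * power_fun M"
    by (metis mult.assoc mult.left_commute)
qed

lemma unit_fun_mult_power_fun: "unit_fun M * power_fun M = unit_fun M"
  by (simp add: unit_fun_def)

lemma rank_bounded_moebius_fun: "rank_bounded moebius_fun"
  by (simp add: rank_bounded_def moebius_fun_def)

lemma rank_bounded_power_fun: "rank_bounded power_fun"
  by (simp add: rank_bounded_def degree_monom_le)

lemma rev_fun_moebius_fun: "rev_fun moebius_fun = (\<lambda>M. moebius_fun M * power_fun M)"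
  by (auto simp: rev_fun_def moebius_fun_def poly_eq_iff coeff_rev_poly coeff_pCons smult_monom
      split: nat.splits)

lemma rev_fun_power_fun: "rev_fun (power_fun :: 'a matroid \<Rightarrow> _) = zeta_fun"
proof
  fix M :: "'a matroid"
  show "rev_fun power_fun M = zeta_fun M"
    by (auto simp: rev_fun_def poly_eq_iff coeff_rev_poly)
qed

lemma rank_bounded_char_poly: "rank_bounded char_poly"
  unfolding char_poly_eq_conv
  by (intro rank_bounded_conv rank_bounded_moebius_fun rank_bounded_power_fun)

lemma rev_fun_char_poly:
  "rev_fun char_poly = conv (\<lambda>M. moebius_fun M * power_fun M) zeta_fun"
  by (simp add: char_poly_eq_conv rev_fun_conv rank_bounded_moebius_fun rank_bounded_power_fun
      rev_fun_moebius_fun rev_fun_power_fun)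

text \<open>The characteristic polynomial is the Moebius function times the powers of t, and its
  reversal is the scaled Moebius function times zeta. In the product zeta meets the Moebius function
  and cancels; what remains is a scaled copy of Moebius inversion.\<close>

lemma conv_rev_char_poly_char_poly: "conv (rev_fun char_poly) char_poly = unit_fun"
proof -
  let ?mt = "\<lambda>M. moebius_fun M * power_fun M"
  have "conv (rev_fun char_poly) char_poly =
      conv ?mt (conv (conv zeta_fun moebius_fun) power_fun)"
    unfolding rev_fun_char_poly by (simp only: char_poly_eq_conv conv_assoc)
  also have "conv (conv zeta_fun moebius_fun) power_fun = power_fun"
    by (auto simp: conv_zeta_moebius conv_unit_left)
  also have "conv ?mt power_fun = (\<lambda>M. conv moebius_fun zeta_fun M * power_fun M)"
    using conv_power_fun_mult[of moebius_fun zeta_fun] by auto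
  also have "\<dots> = unit_fun"
    by (simp only: conv_moebius_zeta unit_fun_mult_power_fun)
  finally show ?thesis .
qed

lemma conv_char_poly_rev_char_poly: "conv char_poly (rev_fun char_poly) = unit_fun"
proof -
  let ?mt = "\<lambda>M. moebius_fun M * power_fun M"
  have "conv char_poly (rev_fun char_poly) =
      conv moebius_fun (conv (conv power_fun ?mt) zeta_fun)"
    unfolding rev_fun_char_poly by (simp only: char_poly_eq_conv conv_assoc)
  also have "conv power_fun ?mt = (\<lambda>M. conv zeta_fun moebius_fun M * power_fun M)"
    using conv_power_fun_mult[of zeta_fun moebius_fun] by auto
  also have "\<dots> = unit_fun"
    by (simp only: conv_zeta_moebius unit_fun_mult_power_fun)
  finally show ?thesis
    by (simp flip: conv_assoc add: conv_moebius_zeta)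
qed

lemma conv_unit_char_poly: "conv unit_fun char_poly = char_poly"
  by (simp add: char_poly_eq_conv conv_unit_moebius flip: conv_assoc)

lemma normalized_char_poly: "normalized char_poly"
  unfolding normalized_def
proof (intro allI impI)
  fix M :: "'a matroid" assume r: "rank M = 0"
  have "flats M = {ground M}"
    using r by (rule flats_rank_0)
  moreover from this have "cl M {} = ground M"
    using loops_in_flats[of M] by auto
  ultimately show "char_poly M = 1"
    using r finite_ground[of M] by (simp add: char_poly_def rank_def moebius.simps monom_0 flip: one_pCons)
qed

section \<open>Kazhdan--Lusztig functions\<close>

definition small :: "('a matroid \<Rightarrow> int poly) \<Rightarrow> bool" where
  "small f \<longleftrightarrow> normalized f \<and> (\<forall>M. rank M > 0 \<longrightarrow> 2 * degree (f M) < rank M)"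

lemma small_normalized: "small f \<Longrightarrow> normalized f"
  by (simp add: small_def)

lemma small_rank_bounded: "small f \<Longrightarrow> rank_bounded f"
  unfolding rank_bounded_def
proof
  fix M :: "'a matroid" assume f: "small f"
  show "degree (f M) \<le> rank M"
  proof (cases "rank M = 0")
    case False
    with f have "2 * degree (f M) < rank M" by (simp add: small_def)
    then show ?thesis by simp
  qed (use f in \<open>simp add: small_def normalized_def\<close>)
qed

lemma small_double_degree_le: "small f \<Longrightarrow> 2 * degree (f M) \<le> rank M"
  unfolding small_def normalized_def by (cases "rank M = 0") (auto intro: less_imp_le)

text \<open>The reflection sends every exponent below n/2 to one above n/2, where the polynomial has
  no terms.\<close>

lemma rev_poly_self_eq_0:
  assumes "rev_poly n p = p" "2 * degree p < n"
  shows "p = 0"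
proof (rule poly_eqI)
  fix i
  have "coeff p i = 0" if "2 * i < n"
  proof -
    have "coeff p i = coeff p (n - i)"
      using arg_cong[OF assms(1), of "\<lambda>q. coeff q i"] that by (simp add: coeff_rev_poly)
    also have "\<dots> = 0"
      using assms(2) that by (intro coeff_eq_0) linarith
    finally show ?thesis .
  qed
  moreover have "coeff p i = 0" if "\<not> 2 * i < n"
    using assms(2) that by (intro coeff_eq_0) linarith
  ultimately show "coeff p i = coeff 0 i" by auto
qed

text \<open>The two half-rank bounds add up to \<open>rank M\<close>. Strictness needs one factor of
  positive rank: the contraction if \<open>F\<close> has rank 0, the restriction otherwise.\<close>

lemma small_conv_degree:
  assumes "small f" "small g" "F \<in> flats M" "rank M > 0"
  shows "2 * degree (f (restriction M F) * g (contraction M F)) < rank M"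
proof -
  have "2 * degree (f (restriction M F)) \<le> rk M F"
      "2 * degree (g (contraction M F)) \<le> rank M - rk M F"
    using small_double_degree_le[OF assms(1)] small_double_degree_le[OF assms(2)] assms(3)
    by (metis rank_restriction_flat, metis rank_contraction_flat)
  moreover have "2 * degree (f (restriction M F)) < rk M F" if "rk M F > 0"
    using assms(1,3) that unfolding small_def by (metis rank_restriction_flat)
  moreover have "2 * degree (g (contraction M F)) < rank M - rk M F" if "rk M F = 0"
    using assms(2,3,4) that unfolding small_def by (metis rank_contraction_flat diff_zero)
  ultimately show ?thesis
    using rk_le_rank[OF assms(3)] degree_mult_le[of "f (restriction M F)" "g (contraction M F)"]
    by (cases "rk M F = 0") fastforce+
qed

lemma conv_rank_0:
  assumes "normalized f" "normalized g" "rank M = 0"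
  shows "conv f g M = 1"
  using assms by (simp add: conv_split normalized_def flats_rank_0)

lemma degree_sum_less_half:
  assumes "finite A" "0 < (n :: nat)" "\<And>x. x \<in> A \<Longrightarrow> 2 * degree (p x) < n"
  shows "2 * degree (\<Sum>x\<in>A. p x) < n"
proof -
  have "degree (\<Sum>x\<in>A. p x) \<le> (n - 1) div 2"
    using assms by (intro degree_sum_le) fastforce+
  with assms(2) show ?thesis by linarith
qed

lemma conv_eq_unit_if_symmetric:
  assumes f: "small f" and g: "small g" and sym: "rev_fun (conv f g) = conv f g"
  shows "conv f g = unit_fun"
proof
  fix M :: "'a matroid"
  show "conv f g M = unit_fun M"
  proof (cases "rank M = 0")
    case True
    then show ?thesis
      using f g by (simp add: conv_rank_0 small_normalized unit_fun_def)
  next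
    case False
    have "2 * degree (conv f g M) < rank M"
      unfolding conv_def using False f g by (intro degree_sum_less_half small_conv_degree) auto
    moreover have "rev_poly (rank M) (conv f g M) = conv f g M"
      using fun_cong[OF sym, of M] by (simp add: rev_fun_def)
    ultimately show ?thesis
      using False by (simp add: rev_poly_self_eq_0 unit_fun_def)
  qed
qed

section \<open>Solving the left recursion\<close>

definition is_right_KL :: "('a matroid \<Rightarrow> int poly) \<Rightarrow> bool" where
  "is_right_KL p \<longleftrightarrow> small p \<and> rev_fun p = conv char_poly p"

definition is_left_KL :: "('a matroid \<Rightarrow> int poly) \<Rightarrow> bool" where
  "is_left_KL q \<longleftrightarrow> small q \<and> rev_fun q = conv q (rev_fun char_poly)"

text \<open>By induction two solutions share the contribution of the proper flats, so their
  difference at \<open>M\<close> is fixed by reversal while its degree is below half the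
  rank.\<close>

lemma left_KL_unique:
  assumes p: "is_left_KL p" and q: "is_left_KL q"
  shows "p = q"
proof
  fix M
  show "p M = q M"
  proof (induction "rank M" arbitrary: M rule: less_induct)
    case less
    show ?case
    proof (cases "rank M = 0")
      case True
      with p q show ?thesis
        by (simp add: is_left_KL_def small_def normalized_def)
    next
      case False
      let ?S = "\<lambda>f. \<Sum>F\<in>flats M - {ground M}. f (restriction M F) * rev_fun char_poly (contraction M F)"
      have expand: "rev_poly (rank M) (f M) = f M + ?S f" if "is_left_KL f" for f
      proof -
        have "rev_fun f M = conv f (rev_fun char_poly) M"
          using that unfolding is_left_KL_def by metis
        then show ?thesis
          by (simp add: rev_fun_def[of f] conv_split
              normalizedD[OF normalized_rev_fun[OF normalized_char_poly]])
      qed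
      have "?S p = ?S q"
        using less by (intro sum.cong) (auto simp: rank_restriction_flat rk_less_rank)
      then have "rev_poly (rank M) (p M - q M) = p M - q M"
        using expand[OF p] expand[OF q] by (simp add: rev_poly_diff)
      moreover have "2 * degree (p M - q M) < rank M"
      proof -
        have "2 * degree (p M) < rank M" "2 * degree (q M) < rank M"
          using p q False by (auto simp: is_left_KL_def small_def)
        then show ?thesis
          using degree_diff_le_max[of "p M" "q M"] by linarith
      qed
      ultimately have "p M - q M = 0"
        by (rule rev_poly_self_eq_0)
      then show ?thesis by simp
    qed
  qed
qed

text \<open>With s the sum over proper flats, the recursion demands rev q = q + s. Since rev q lives
  above half the rank, q must be minus the part of s below it. The cutoff keeps exponents
  \<open>i < (r + 1) div 2\<close>, that is, \<open>2 * i < r\<close>.\<close>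

function left_KL :: "'a matroid \<Rightarrow> int poly" where
  "left_KL M = (if rank M = 0 then 1 else
     - poly_cutoff ((rank M + 1) div 2)
         (\<Sum>F\<in>flats M - {ground M}. left_KL (restriction M F) * rev_fun char_poly (contraction M F)))"
  by auto
termination
  by (relation "Wellfounded.measure rank") (auto simp: rank_restriction_flat rk_less_rank)

declare left_KL.simps [simp del]

text \<open>An antisymmetric s is its lower half minus the mirror image of that half.\<close>

lemma rev_poly_cutoff_diff:
  assumes "rev_poly n s = - s"
  shows "rev_poly n (- poly_cutoff ((n + 1) div 2) s) = - poly_cutoff ((n + 1) div 2) s + s"
proof (rule poly_eqI)
  fix i
  have c: "coeff (rev_poly n s) i = - coeff s i"
    using assms by simp
  show "coeff (rev_poly n (- poly_cutoff ((n + 1) div 2) s)) i =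
      coeff (- poly_cutoff ((n + 1) div 2) s + s) i"
  proof (cases "i \<le> n \<and> 2 * i = n")
    \<comment> \<open>The middle coefficient, present only for even n, equals its own negative and
      so vanishes; the cutoff omits it.\<close>
    case True
    then have "n - i = i" by linarith
    with True c show ?thesis
      by (auto simp: coeff_rev_poly coeff_poly_cutoff)
  next
    case False
    with c show ?thesis
      by (auto simp: coeff_rev_poly coeff_poly_cutoff split: if_splits)
  qed
qed

lemma small_left_KL: "small left_KL"
  unfolding small_def normalized_def
proof (intro conjI allI impI)
  fix M :: "'a matroid"
  show "left_KL M = 1" if "rank M = 0"
    using that by (simp add: left_KL.simps)
  assume r: "rank M > 0"
  have "degree (left_KL M) \<le> (rank M - 1) div 2"
    using r by (intro degree_le) (auto simp: left_KL.simps[of M] coeff_poly_cutoff)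
  with r show "2 * degree (left_KL M) < rank M"
    by linarith
qed

text \<open>The point is that s is antisymmetric, which makes the truncation a genuine solution. The
  induction hypothesis at proper flats provides this.\<close>

lemma rev_fun_left_KL: "rev_fun left_KL = conv left_KL (rev_fun char_poly)"
proof
  fix M :: "'a matroid"
  let ?k = "rev_fun char_poly :: 'a matroid \<Rightarrow> int poly"
  have k: "normalized ?k"
    by (intro normalized_rev_fun normalized_char_poly)
  show "rev_fun left_KL M = conv left_KL ?k M"
  proof (induction "rank M" arbitrary: M rule: less_induct)
    case less
    show ?case
    proof (cases "rank M = 0")
      case True
      then show ?thesis
        using normalizedD[OF normalized_rev_fun[OF small_normalized[OF small_left_KL]], of M]
          conv_rank_0[OF small_normalized[OF small_left_KL] k, of M]
        by simp
    next
      case False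
      let ?L = "flats M - {ground M}"
      let ?s = "\<Sum>F\<in>?L. left_KL (restriction M F) * ?k (contraction M F)"
      have split: "conv left_KL ?k M = left_KL M + ?s"
        using k by (simp add: conv_split normalizedD)
      have "rev_poly (rank M) ?s =
          (\<Sum>F\<in>?L. rev_fun left_KL (restriction M F) * rev_fun ?k (contraction M F))"
        unfolding rev_poly_sum
        by (intro sum.cong refl rev_poly_conv_term small_rank_bounded small_left_KL rank_bounded_rev_fun)
          simp
      also have "\<dots> = (\<Sum>F\<in>?L. conv left_KL ?k (restriction M F) * char_poly (contraction M F))"
        using less
        by (intro sum.cong)
          (auto simp: rank_restriction_flat rk_less_rank rev_fun_rev_fun rank_bounded_char_poly)
      \<comment> \<open>Completing the sum by its top term turns it into a full convolution, in
        which \<open>?k\<close> and \<open>char_poly\<close> cancel. This leaves q - (q + s) =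
        -s.\<close>
      also have "\<dots> = conv (conv left_KL ?k) char_poly M - conv left_KL ?k M"
        by (simp add: conv_split[of "conv left_KL ?k"] normalizedD[OF normalized_char_poly])
      also have "conv (conv left_KL ?k) char_poly = left_KL"
        by (simp add: conv_assoc conv_rev_char_poly_char_poly)
      finally have "rev_poly (rank M) ?s = - ?s"
        by (simp add: split)
      from rev_poly_cutoff_diff[OF this] show ?thesis
        using False by (simp add: split rev_fun_def[of left_KL] left_KL.simps[of M])
    qed
  qed
qed

lemma is_left_KL_left_KL: "is_left_KL left_KL"
  by (simp add: is_left_KL_def small_left_KL rev_fun_left_KL)

section \<open>The right solution as a convolution inverse\<close>

definition right_KL :: "'a matroid \<Rightarrow> int poly" where
  "right_KL = left_inverse left_KL"

lemma conv_right_KL_left_KL: "conv right_KL left_KL = unit_fun"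
  unfolding right_KL_def
  by (intro conv_left_inverse small_normalized small_left_KL)

lemma small_right_KL: "small right_KL"
  unfolding small_def
proof (intro conjI allI impI)
  show norm: "normalized (right_KL :: 'a matroid \<Rightarrow> _)"
    by (simp add: right_KL_def left_inverse_normalized)
  fix M :: "'a matroid"
  show "rank M > 0 \<Longrightarrow> 2 * degree (right_KL M) < rank M"
  proof (induction "rank M" arbitrary: M rule: less_induct)
    case less
    let ?t = "\<lambda>F. right_KL (restriction M F) * left_KL (contraction M F)"
    have "2 * degree (?t F) < rank M" if F: "F \<in> flats M - {ground M}" for F
    proof -
      have lt: "rk M F < rank M"
        using F rk_less_rank by auto
      \<comment> \<open>The bound is weak since \<open>F\<close> may have rank 0; strictness comes
        from the contraction, which has positive rank for proper \<open>F\<close>.\<close>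
      have "2 * degree (right_KL (restriction M F)) \<le> rk M F"
      proof (cases "rk M F = 0")
        case True
        then show ?thesis
          using norm F by (simp add: normalizedD rank_restriction_flat)
      next
        case False
        then show ?thesis
          using less.hyps[of "restriction M F"] lt F by (simp add: rank_restriction_flat)
      qed
      moreover have "2 * degree (left_KL (contraction M F)) < rank M - rk M F"
        using small_left_KL F lt unfolding small_def
        by (metis DiffD1 rank_contraction_flat zero_less_diff)
      ultimately show ?thesis
        using lt degree_mult_le[of "right_KL (restriction M F)" "left_KL (contraction M F)"]
        by linarith
    qed
    then have "2 * degree (\<Sum>F\<in>flats M - {ground M}. ?t F) < rank M"
      using less.prems by (intro degree_sum_less_half) auto
    then show ?case
      using less.prems by (simp add: right_KL_def left_inverse.simps[of _ M] unit_fun_def)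
  qed
qed

text \<open>Multiplied on the right by the reversal of \<open>left_KL\<close>, both sides become
  \<open>unit_fun\<close>, and this factor can be cancelled.\<close>

lemma is_right_KL_right_KL: "is_right_KL right_KL"
  unfolding is_right_KL_def
proof
  show "small right_KL" by (rule small_right_KL)
  let ?p = right_KL and ?q = left_KL and ?k = char_poly
  note bounded = small_rank_bounded[OF small_right_KL] small_rank_bounded[OF small_left_KL]
  show "rev_fun ?p = conv ?k ?p"
  proof (rule conv_right_cancel)
    show "normalized (rev_fun ?q)"
      by (intro normalized_rev_fun small_normalized small_left_KL)
    have "conv (rev_fun ?p) (rev_fun ?q) = unit_fun"
      by (simp add: conv_right_KL_left_KL bounded flip: rev_fun_conv)
    \<comment> \<open>The inner product is \<open>unit_fun\<close>, standing on the left of the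
      reversed characteristic polynomial; loop invariance of the latter removes it.\<close>
    also have "\<dots> = conv ?k (conv (conv ?p ?q) (rev_fun ?k))"
      by (simp add: conv_right_KL_left_KL conv_unit_left_rev_fun conv_unit_char_poly
          conv_char_poly_rev_char_poly)
    also have "\<dots> = conv (conv ?k ?p) (rev_fun ?q)"
      by (simp only: conv_assoc rev_fun_left_KL)
    finally show "conv (rev_fun ?p) (rev_fun ?q) = conv (conv ?k ?p) (rev_fun ?q)" .
  qed
qed

text \<open>Stated for an arbitrary solution \<open>p\<close>, because uniqueness of the right
  solution is deduced from it.\<close>

lemma conv_left_KL_right_KL:
  assumes "is_right_KL p"
  shows "conv left_KL p = unit_fun"
proof (rule conv_eq_unit_if_symmetric)
  show small: "small left_KL" "small p"
    using assms by (auto simp: small_left_KL is_right_KL_def)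
  have "rev_fun (conv left_KL p) = conv (rev_fun left_KL) (rev_fun p)"
    using small by (intro rev_fun_conv small_rank_bounded)
  also have "\<dots> = conv left_KL (conv (conv (rev_fun char_poly) char_poly) p)"
    using assms by (simp add: is_right_KL_def rev_fun_left_KL conv_assoc)
  also have "\<dots> = conv left_KL p"
    unfolding conv_rev_char_poly_char_poly by (simp flip: conv_assoc)
  finally show "rev_fun (conv left_KL p) = conv left_KL p" .
qed

lemma right_KL_unique:
  assumes p: "is_right_KL p"
  shows "p = right_KL"
proof -
  have bounded: "rank_bounded p"
    using p by (auto simp: is_right_KL_def intro: small_rank_bounded)
  have "rev_fun (conv unit_fun p) = conv unit_fun (conv char_poly p)"
    using p by (simp add: is_right_KL_def flip: conv_unit_left_rev_fun)
  also have "\<dots> = rev_fun p"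
    using p by (simp add: conv_unit_char_poly is_right_KL_def flip: conv_assoc)
  finally have "rev_fun (rev_fun (conv unit_fun p)) = rev_fun (rev_fun p)"
    by simp
  \<comment> \<open>A solution inherits loop invariance from the characteristic polynomial through
    its recursion. Hence \<open>left_KL\<close> can be inserted between \<open>right_KL\<close> and
    \<open>p\<close>, and associativity identifies the two.\<close>
  then have "p = conv unit_fun p"
    using bounded by (simp add: rev_fun_rev_fun rank_bounded_conv rank_bounded_unit)
  also have "\<dots> = conv right_KL (conv left_KL p)"
    by (simp add: conv_right_KL_left_KL flip: conv_assoc)
  also have "\<dots> = right_KL"
    by (simp add: conv_left_KL_right_KL[OF p])
  finally show ?thesis .
qed

section \<open>Comparison with the defining recursions\<close>

lemma half_less_iff: "real d < real r / 2 \<longleftrightarrow> 2 * d < r"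
  by linarith

lemma is_KL_assignment_iff: "is_KL_assignment P \<longleftrightarrow> is_right_KL P"
  unfolding is_KL_assignment_def is_right_KL_def small_def normalized_def half_less_iff
  by (auto simp: fun_eq_iff rev_fun_def conv_def)

lemma KL_poly_eq: "KL_poly = right_KL"
  unfolding KL_poly_def is_KL_assignment_iff
  by (rule the_equality) (auto simp: is_right_KL_right_KL intro: right_KL_unique)

definition sign_twist :: "('a matroid \<Rightarrow> int poly) \<Rightarrow> 'a matroid \<Rightarrow> int poly" where
  "sign_twist q M = (- 1) ^ rank M * q M"

lemma sign_mult: "(- 1) ^ n * p = (if even n then p else - p :: int poly)"
  by simp

lemma sign_twist_sign_twist: "sign_twist (sign_twist q) = q"
  by (auto simp: sign_twist_def sign_mult)

lemma rev_poly_minus: "rev_poly n (- p) = - rev_poly n p"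
  by (rule poly_eqI) (simp add: coeff_rev_poly)

text \<open>The twist absorbs both signs of the inverse recursion: the power at
  \<open>rank M\<close> goes into the reversed side, the power at \<open>rk M F\<close> into the
  value at the restriction.\<close>

lemma is_inverse_KL_assignment_iff: "is_inverse_KL_assignment Q \<longleftrightarrow> is_left_KL (sign_twist Q)"
proof -
  have "rev_fun (sign_twist Q) M = (- 1) ^ rank M * rev_poly (rank M) (Q M)" for M
    by (simp add: rev_fun_def sign_twist_def sign_mult rev_poly_minus)
  moreover have "conv (sign_twist Q) (rev_fun char_poly) M =
      (\<Sum>F\<in>flats M. (- 1) ^ rk M F * Q (restriction M F) *
         rev_poly (rank M - rk M F) (char_poly (contraction M F)))" for M
    unfolding conv_def
    by (intro sum.cong) (simp_all add: sign_twist_def rev_fun_def rank_restriction_flat rank_contraction_flat)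
  moreover have "degree (sign_twist Q M) = degree (Q M)" for M
    by (simp add: sign_twist_def sign_mult)
  moreover have "sign_twist Q M = Q M" if "rank M = 0" for M
    using that by (simp add: sign_twist_def)
  ultimately show ?thesis
    unfolding is_inverse_KL_assignment_def is_left_KL_def small_def normalized_def half_less_iff
    by (auto simp: fun_eq_iff)
qed

lemma inverse_KL_poly_eq: "inverse_KL_poly = sign_twist left_KL"
  unfolding inverse_KL_poly_def is_inverse_KL_assignment_iff
proof (rule the_equality)
  show "is_left_KL (sign_twist (sign_twist left_KL))"
    by (simp add: sign_twist_sign_twist is_left_KL_left_KL)
  show "Q = sign_twist left_KL" if "is_left_KL (sign_twist Q)" for Q
    using left_KL_unique[OF that is_left_KL_left_KL] by (metis sign_twist_sign_twist)
qed

section \<open>Comparison of the middle coefficients\<close>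

lemma coeff_right_KL_eq:
  assumes "odd (rank M)"
  shows "coeff (right_KL M) ((rank M - 1) div 2) = - coeff (left_KL M) ((rank M - 1) div 2)"
proof -
  let ?n = "(rank M - 1) div 2" and ?E = "ground M" and ?O = "cl M {}"
  let ?t = "\<lambda>F. left_KL (restriction M F) * right_KL (contraction M F)"
  have pos: "rank M > 0"
    using assms odd_pos by blast
  have "?O \<noteq> ?E"
    using pos by (metis less_irrefl rank_def rk_loops)
  have "coeff (?t F) ?n = 0" if "F \<in> flats M - {?E} - {?O}" for F
  proof -
    have F: "F \<in> flats M" and "0 < rk M F" "rk M F < rank M"
      using that rk_less_rank flat_rk_0_iff by auto
    then have "2 * degree (left_KL (restriction M F)) < rk M F"
        "2 * degree (right_KL (contraction M F)) < rank M - rk M F"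
      using small_left_KL small_right_KL unfolding small_def
      by (metis rank_restriction_flat, metis rank_contraction_flat zero_less_diff)
    \<comment> \<open>Both factors satisfy strict bounds, so twice the degree of the product is at
      most \<open>rank M - 2 = 2 * k - 1\<close>; by parity the degree is below
      \<open>k\<close>.\<close>
    moreover obtain k where "rank M = 2 * k + 1"
      using assms by (rule oddE)
    ultimately have "degree (?t F) < ?n"
      using degree_mult_le[of "left_KL (restriction M F)" "right_KL (contraction M F)"]
      by simp
    then show ?thesis by (rule coeff_eq_0)
  qed
  then have "(\<Sum>F\<in>flats M - {?E} - {?O}. coeff (?t F) ?n) = 0"
    by (intro sum.neutral) blast
  moreover have "conv left_KL right_KL M = 0"
    using pos by (simp add: conv_left_KL_right_KL[OF is_right_KL_right_KL] unit_fun_def)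
  then have "(\<Sum>F\<in>flats M. coeff (?t F) ?n) = 0"
    unfolding conv_def by (metis coeff_0 coeff_sum)
  ultimately have "coeff (?t ?E) ?n + coeff (?t ?O) ?n = 0"
    using \<open>?O \<noteq> ?E\<close> by (simp add: sum.remove[of "flats M" ?E] sum.remove[of "flats M - {?E}" ?O])
  moreover have "right_KL (contraction M ?E) = 1"
    by (simp add: normalizedD[OF small_normalized[OF small_right_KL]])
  moreover have "left_KL (restriction M ?O) = 1"
    by (simp add: normalizedD[OF small_normalized[OF small_left_KL]] rank_restriction_flat)
  moreover have "right_KL (contraction M ?O) = right_KL M"
  proof -
    \<comment> \<open>The bottom flat contributes the value at the contraction by the loops. The
      two-sided inverse relation carries it back to \<open>M\<close>.\<close>
    have "conv unit_fun right_KL = conv right_KL (conv left_KL right_KL)"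
      by (simp add: conv_right_KL_left_KL flip: conv_assoc)
    also have "\<dots> = right_KL"
      by (simp add: conv_left_KL_right_KL[OF is_right_KL_right_KL])
    finally show ?thesis
      by (metis conv_unit_left)
  qed
  ultimately show ?thesis by simp
qed

theorem theorem4p1:
  fixes M :: "'a matroid"
  assumes "odd (rank M)"
  shows "coeff (KL_poly M) ((rank M - 1) div 2) =
           coeff (inverse_KL_poly M) ((rank M - 1) div 2) \<and>
         (\<not> degenerate M \<longleftrightarrow> degree (inverse_KL_poly M) = (rank M - 1) div 2)"
proof
  let ?n = "(rank M - 1) div 2"
  let ?p = "KL_poly M" and ?q = "inverse_KL_poly M"
  \<comment> \<open>The sign of the twist in odd rank cancels the minus sign in
    \<open>coeff_right_KL_eq\<close>.\<close>
  have q: "?q = - left_KL M"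
    using assms by (simp add: inverse_KL_poly_eq sign_twist_def sign_mult)
  show eq: "coeff ?p ?n = coeff ?q ?n"
    using coeff_right_KL_eq[OF assms] by (simp add: KL_poly_eq q)
  have "2 * degree ?p < rank M" "2 * degree ?q < rank M"
    using small_left_KL small_right_KL odd_pos[OF assms] by (auto simp: q KL_poly_eq small_def)
  then have "degree ?p \<le> ?n" "degree ?q \<le> ?n"
    by linarith+
  \<comment> \<open>The case \<open>?n = 0\<close> is separate because the zero polynomial also has
    degree 0. In that case both degrees are 0 and the equivalence still holds.\<close>
  moreover have top: "degree f = ?n \<longleftrightarrow> coeff f ?n \<noteq> 0 \<or> ?n = 0" if "degree f \<le> ?n" for f :: "int poly"
    using that le_degree[of f ?n] by (metis antisym degree_0 leading_coeff_0_iff le_zero_eq)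
  ultimately show "\<not> degenerate M \<longleftrightarrow> degree ?q = ?n"
    using eq by (auto simp: degenerate_def)
qed

end
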